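(* Let $(M,\circ,e,\tilde{\mathcal{S}},u)$ be an $F$-manifold with a special family of connections $\tilde{\mathcal{S}}$ and a Legendre field $u$. Let $\mathcal{E}$ be an eventual identity on $(M,\circ,e)$ and $(M,*,\mathcal{E},e,\mathcal{S})$ the dual of $(M,\circ,e,\mathcal{E},\tilde{\mathcal{S}})$, i.e. $X*Y=X\circ Y\circ\mathcal{E}^{-1}$ and $\mathcal{S}=\mathcal{D}_{\mathcal{E}}(\tilde{\mathcal{S}})$. Then $\mathcal{E}\circ u$ is a Legendre field on $(M,*,\mathcal{E},\mathcal{S})$ and $$\mathcal{L}_{\mathcal{E}\circ u}(\mathcal{S})=(\mathcal{D}_{\mathcal{E}}\circ\mathcal{L}_{u})(\tilde{\mathcal{S}}),$$ where $(\mathcal{D}_{\mathcal{E}}\circ\mathcal{L}_{u})(\tilde{\mathcal{S}})$ is the image of the special family $\mathcal{L}_{u}(\tilde{\mathcal{S}})$ on $(M,\circ,e)$ through the duality defined by $\mathcal{E}$.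
   Context: Everything is in the smooth category; $\mathcal{X}(M)$ denotes the vector fields on the manifold $M$. $F$-manifold: a triple $(M,\circ,e)$ where $M$ is a manifold and $\circ$ is a fiber-preserving commutative, associative, bilinear multiplication on $TM$ with unit field $e$, such that $L_{X\circ Y}(\circ)=X\circ L_{Y}(\circ)+Y\circ L_{X}(\circ)$ for all $X,Y\in\mathcal{X}(M)$, where $L_{Z}(\circ)(X,Y)=[Z,X\circ Y]-[Z,X]\circ Y-X\circ[Z,Y]$. Invertible vector field: $\mathcal{E}$ is invertible if there is a vector field $\mathcal{E}^{-1}$ with $\mathcal{E}\circ\mathcal{E}^{-1}=e$. Eventual identity on an $F$-manifold $(M,\circ,e)$: an invertible vector field $\mathcal{E}$ such that the multiplication $X*Y:=X\circ Y\circ\mathcal{E}^{-1}$ (whose unit field is $\mathcal{E}$) defines an $F$-manifold $(M,*,\mathcal{E})$, called the dual $F$-manifold. Compatible connection: a connection $\nabla$ on $TM$ is compatible with a commutative, associative multiplication $\circ$ on $TM$ if $\nabla_{X}(\circ)(Y,Z):=\nabla_{X}(Y\circ Z)-\nabla_{X}(Y)\circ Z-Y\circ\nabla_{X}(Z)$ is totally symmetric in $X,Y,Z$. Special family: a family of connections $\tilde{\mathcal{S}}$ on an $F$-manifold $(M,\circ,e)$ is special if $\tilde{\mathcal{S}}=\{\tilde{\nabla}^{V},\ V\in\mathcal{X}(M)\}$ where $\tilde{\nabla}^{V}_{X}(Y):=\tilde{\nabla}_{X}(Y)+V\circ X\circ Y$ and $\tilde{\nabla}$ is torsion-free and compatible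 with $\circ$. Dual family (duality defined by $\mathcal{E}$): for a special family $\tilde{\mathcal{S}}$ on $(M,\circ,e)$, $\mathcal{D}_{\mathcal{E}}(\tilde{\mathcal{S}})=\{\nabla^{W},\ W\in\mathcal{X}(M)\}$ where $\nabla^{W}_{X}(Y)=\mathcal{E}\circ\tilde{\nabla}_{X}(\mathcal{E}^{-1}\circ Y)-\tilde{\nabla}_{\mathcal{E}^{-1}\circ Y}(\mathcal{E})\circ X+W*X*Y$ and $\tilde{\nabla}\in\tilde{\mathcal{S}}$ is any connection of the family (the result does not depend on this choice); it is a special family on $(M,*,\mathcal{E})$. Legendre field: a vector field $u$ on an $F$-manifold $(M,\circ,e,\tilde{\mathcal{S}})$ with a special family $\tilde{\mathcal{S}}$ is a Legendre field if it is invertible (with respect to $\circ$) and, for one (equivalently, any) $\tilde{\nabla}\in\tilde{\mathcal{S}}$, $\tilde{\nabla}_{X}(u)\circ Y=\tilde{\nabla}_{Y}(u)\circ X$ for all $X,Y\in\mathcal{X}(M)$. Legendre transformation: $\mathcal{L}_{u}(\tilde{\mathcal{S}})=\{\mathcal{L}_{u}(\tilde{\nabla}),\ \tilde{\nabla}\in\tilde{\mathcal{S}}\}$, where $\mathcal{L}_{u}(\tilde{\nabla})_{X}(Y)=u^{-1}\circ\tilde{\nabla}_{X}(u\circ Y)$; it is again a special family on $(M,\circ,e)$. For $(M,*,\mathcal{E},\mathcal{S})$ the same definitions are used with $*$ in place of $\circ$ and inverses taken with respect to $*$. *)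

theory Defs
  imports "HOL-Analysis.Analysis" "HOL-Library.Function_Algebras"
begin

section \<open>Smooth manifolds\<close>

text \<open>
  \<open>Ck_on k S f\<close>: on the open set \<open>S\<close> of a finite-dimensional space, \<open>f\<close> is \<open>k\<close> times
  continuously differentiable.
\<close>

fun Ck_on :: "nat \<Rightarrow> 'e::real_normed_vector set \<Rightarrow> ('e \<Rightarrow> 'f::real_normed_vector) \<Rightarrow> bool" where
  "Ck_on 0 S f \<longleftrightarrow> continuous_on S f"
| "Ck_on (Suc k) S f \<longleftrightarrow>
     (\<forall>x\<in>S. f differentiable (at x)) \<and>
     (\<forall>v. Ck_on k S (\<lambda>x. frechet_derivative f (at x) v))"

definition smooth_on :: "'e::real_normed_vector set \<Rightarrow> ('e \<Rightarrow> 'f::real_normed_vector) \<Rightarrow> bool" where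
  "smooth_on S f \<longleftrightarrow> (\<forall>k. Ck_on k S f)"

text \<open>
  The manifold is the whole type \<open>'a\<close>, Hausdorff and second countable by its type class. A chart
  is a pair of a domain and a coordinate map (whose values off the domain are irrelevant). The
  model space \<open>'e\<close> is any finite-dimensional real normed space, so that dimension 0 is allowed.
\<close>

type_synonym ('a, 'e) atlas = "('a set \<times> ('a \<Rightarrow> 'e)) set"

definition smooth_manifold ::
    "('a::{t2_space,second_countable_topology}, 'e::real_normed_vector) atlas \<Rightarrow> bool" where
  "smooth_manifold A \<longleftrightarrow>
     (\<exists>B :: 'e set. finite B \<and> span B = UNIV) \<and>
     (\<Union>(U, \<phi>)\<in>A. U) = UNIV \<and>
     (\<forall>(U, \<phi>)\<in>A. open U \<and> open (\<phi> ` U) \<and> homeomorphism U (\<phi> ` U) \<phi> (inv_into U \<phi>)) \<and>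
     (\<forall>(U, \<phi>)\<in>A. \<forall>(V, \<psi>)\<in>A. smooth_on (\<phi> ` (U \<inter> V)) (\<psi> \<circ> inv_into U \<phi>))"

definition smooth_funs :: "('a, 'e::real_normed_vector) atlas \<Rightarrow> ('a \<Rightarrow> real) set" where
  "smooth_funs A = {f. \<forall>(U, \<phi>)\<in>A. smooth_on (\<phi> ` U) (f \<circ> inv_into U \<phi>)}"

section \<open>Vector fields\<close>

text \<open>
  Tangent vectors at \<open>p\<close> are the derivations at \<open>p\<close> of the algebra of smooth functions, made
  extensional by the value 0 on functions that are not smooth. Sums and differences of tangent
  vectors, of vector fields and of functions are the pointwise ones.
\<close>

type_synonym 'a tvec = "('a \<Rightarrow> real) \<Rightarrow> real"
type_synonym 'a vfield = "'a \<Rightarrow> 'a tvec"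

definition tscale :: "real \<Rightarrow> 'a tvec \<Rightarrow> 'a tvec" where
  "tscale c v = (\<lambda>f. c * v f)"

definition fscale :: "('a \<Rightarrow> real) \<Rightarrow> 'a vfield \<Rightarrow> 'a vfield" where
  "fscale f X = (\<lambda>p. tscale (f p) (X p))"

definition tangent_space :: "('a, 'e::real_normed_vector) atlas \<Rightarrow> 'a \<Rightarrow> 'a tvec set" where
  "tangent_space A p = {v.
     (\<forall>f\<in>smooth_funs A. \<forall>g\<in>smooth_funs A. v (\<lambda>q. f q + g q) = v f + v g) \<and>
     (\<forall>f\<in>smooth_funs A. \<forall>c. v (\<lambda>q. c * f q) = c * v f) \<and>
     (\<forall>f\<in>smooth_funs A. \<forall>g\<in>smooth_funs A. v (\<lambda>q. f q * g q) = f p * v g + g p * v f) \<and>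
     (\<forall>f. f \<notin> smooth_funs A \<longrightarrow> v f = 0)}"

definition deriv_along :: "'a vfield \<Rightarrow> ('a \<Rightarrow> real) \<Rightarrow> 'a \<Rightarrow> real" where
  "deriv_along X f = (\<lambda>p. X p f)"

text \<open>A section of the tangent bundle is smooth iff it maps smooth functions to smooth functions.\<close>

definition vfields :: "('a, 'e::real_normed_vector) atlas \<Rightarrow> 'a vfield set" where
  "vfields A = {X. (\<forall>p. X p \<in> tangent_space A p) \<and>
                   (\<forall>f\<in>smooth_funs A. deriv_along X f \<in> smooth_funs A)}"

text \<open>
  On vector fields the bracket vanishes on non-smooth functions, so it is again extensional.
\<close>

definition lie_bracket :: "'a vfield \<Rightarrow> 'a vfield \<Rightarrow> 'a vfield" where
  "lie_bracket X Y = (\<lambda>p f. X p (deriv_along Y f) - Y p (deriv_along X f))"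

section \<open>Multiplications on the tangent bundle and F-manifolds\<close>

type_synonym 'a tmult = "'a \<Rightarrow> 'a tvec \<Rightarrow> 'a tvec \<Rightarrow> 'a tvec"

definition vmult :: "'a vfield \<Rightarrow> 'a tmult \<Rightarrow> 'a vfield \<Rightarrow> 'a vfield"
    ("(_ \<odot>\<^bsub>_\<^esub>/ _)" [75, 0, 76] 75) where
  "X \<odot>\<^bsub>m\<^esub> Y = (\<lambda>p. m p (X p) (Y p))"

definition tangent_mult :: "('a, 'e::real_normed_vector) atlas \<Rightarrow> 'a tmult \<Rightarrow> bool" where
  "tangent_mult A m \<longleftrightarrow>
     (\<forall>p. \<forall>u\<in>tangent_space A p. \<forall>v\<in>tangent_space A p.
        m p u v \<in> tangent_space A p \<and>
        m p u v = m p v u \<and>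
        (\<forall>c. m p (tscale c u) v = tscale c (m p u v)) \<and>
        (\<forall>c. m p u (tscale c v) = tscale c (m p u v)) \<and>
        (\<forall>w\<in>tangent_space A p.
           m p (m p u v) w = m p u (m p v w) \<and>
           m p (u + v) w = m p u w + m p v w \<and>
           m p w (u + v) = m p w u + m p w v)) \<and>
     (\<forall>X\<in>vfields A. \<forall>Y\<in>vfields A. X \<odot>\<^bsub>m\<^esub> Y \<in> vfields A)"

definition unit_field :: "('a, 'e::real_normed_vector) atlas \<Rightarrow> 'a tmult \<Rightarrow> 'a vfield \<Rightarrow> bool" where
  "unit_field A m e \<longleftrightarrow>
     e \<in> vfields A \<and> (\<forall>p. \<forall>v\<in>tangent_space A p. m p (e p) v = v \<and> m p v (e p) = v)"

definition lie_deriv_mult ::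
    "'a tmult \<Rightarrow> 'a vfield \<Rightarrow> 'a vfield \<Rightarrow> 'a vfield \<Rightarrow> 'a vfield" where
  "lie_deriv_mult m Z X Y =
     lie_bracket Z (X \<odot>\<^bsub>m\<^esub> Y) - lie_bracket Z X \<odot>\<^bsub>m\<^esub> Y - X \<odot>\<^bsub>m\<^esub> lie_bracket Z Y"

definition F_manifold ::
    "('a::{t2_space,second_countable_topology}, 'e::real_normed_vector) atlas \<Rightarrow>
      'a tmult \<Rightarrow> 'a vfield \<Rightarrow> bool" where
  "F_manifold A m e \<longleftrightarrow>
     smooth_manifold A \<and> tangent_mult A m \<and> unit_field A m e \<and>
     (\<forall>X\<in>vfields A. \<forall>Y\<in>vfields A. \<forall>Z\<in>vfields A. \<forall>W\<in>vfields A.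
        lie_deriv_mult m (X \<odot>\<^bsub>m\<^esub> Y) Z W =
          X \<odot>\<^bsub>m\<^esub> lie_deriv_mult m Y Z W + Y \<odot>\<^bsub>m\<^esub> lie_deriv_mult m X Z W)"

definition invertible_field ::
    "('a, 'e::real_normed_vector) atlas \<Rightarrow> 'a tmult \<Rightarrow> 'a vfield \<Rightarrow> 'a vfield \<Rightarrow> bool" where
  "invertible_field A m e X \<longleftrightarrow> X \<in> vfields A \<and> (\<exists>Y\<in>vfields A. X \<odot>\<^bsub>m\<^esub> Y = e)"

definition inverse_field ::
    "('a, 'e::real_normed_vector) atlas \<Rightarrow> 'a tmult \<Rightarrow> 'a vfield \<Rightarrow> 'a vfield \<Rightarrow> 'a vfield" where
  "inverse_field A m e X = (THE Y. Y \<in> vfields A \<and> X \<odot>\<^bsub>m\<^esub> Y = e)"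

definition dual_mult ::
    "('a, 'e::real_normed_vector) atlas \<Rightarrow> 'a tmult \<Rightarrow> 'a vfield \<Rightarrow> 'a vfield \<Rightarrow> 'a tmult" where
  "dual_mult A m e E = (\<lambda>p u v. m p (m p u v) (inverse_field A m e E p))"

definition eventual_identity ::
    "('a::{t2_space,second_countable_topology}, 'e::real_normed_vector) atlas \<Rightarrow>
      'a tmult \<Rightarrow> 'a vfield \<Rightarrow> 'a vfield \<Rightarrow> bool" where
  "eventual_identity A m e E \<longleftrightarrow>
     F_manifold A m e \<and> invertible_field A m e E \<and> F_manifold A (dual_mult A m e E) E"

section \<open>Connections and special families\<close>

text \<open>
  Connections are extensional functions on pairs of vector fields, which makes
  equality of families of connections meaningful; \<open>D X Y\<close> is the covariant derivative of \<open>Y\<close>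
  along \<open>X\<close>.
\<close>

type_synonym 'a conn = "'a vfield \<Rightarrow> 'a vfield \<Rightarrow> 'a vfield"

definition connection :: "('a, 'e::real_normed_vector) atlas \<Rightarrow> 'a conn \<Rightarrow> bool" where
  "connection A D \<longleftrightarrow>
     D \<in> vfields A \<rightarrow>\<^sub>E (vfields A \<rightarrow>\<^sub>E vfields A) \<and>
     (\<forall>X\<in>vfields A. \<forall>Y\<in>vfields A. \<forall>Z\<in>vfields A.
        D (X + Y) Z = D X Z + D Y Z \<and> D X (Y + Z) = D X Y + D X Z) \<and>
     (\<forall>f\<in>smooth_funs A. \<forall>X\<in>vfields A. \<forall>Y\<in>vfields A.
        D (fscale f X) Y = fscale f (D X Y) \<and>
        D X (fscale f Y) = fscale (deriv_along X f) Y + fscale f (D X Y))"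

definition torsion_free :: "('a, 'e::real_normed_vector) atlas \<Rightarrow> 'a conn \<Rightarrow> bool" where
  "torsion_free A D \<longleftrightarrow>
     (\<forall>X\<in>vfields A. \<forall>Y\<in>vfields A. D X Y - D Y X = lie_bracket X Y)"

definition cov_deriv_mult ::
    "'a tmult \<Rightarrow> 'a conn \<Rightarrow> 'a vfield \<Rightarrow> 'a vfield \<Rightarrow> 'a vfield \<Rightarrow> 'a vfield" where
  "cov_deriv_mult m D X Y Z = D X (Y \<odot>\<^bsub>m\<^esub> Z) - D X Y \<odot>\<^bsub>m\<^esub> Z - Y \<odot>\<^bsub>m\<^esub> D X Z"

text \<open>The two transpositions below generate all permutations of \<open>X\<close>, \<open>Y\<close>, \<open>Z\<close>.\<close>

definition compatible_conn ::
    "('a, 'e::real_normed_vector) atlas \<Rightarrow> 'a tmult \<Rightarrow> 'a conn \<Rightarrow> bool" where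
  "compatible_conn A m D \<longleftrightarrow>
     (\<forall>X\<in>vfields A. \<forall>Y\<in>vfields A. \<forall>Z\<in>vfields A.
        cov_deriv_mult m D X Y Z = cov_deriv_mult m D Y X Z \<and>
        cov_deriv_mult m D X Y Z = cov_deriv_mult m D X Z Y)"

definition shift_conn ::
    "('a, 'e::real_normed_vector) atlas \<Rightarrow> 'a tmult \<Rightarrow> 'a conn \<Rightarrow> 'a vfield \<Rightarrow> 'a conn" where
  "shift_conn A m D V = (\<lambda>X\<in>vfields A. \<lambda>Y\<in>vfields A. D X Y + V \<odot>\<^bsub>m\<^esub> X \<odot>\<^bsub>m\<^esub> Y)"

definition special_family ::
    "('a::{t2_space,second_countable_topology}, 'e::real_normed_vector) atlas \<Rightarrow>
      'a tmult \<Rightarrow> 'a vfield \<Rightarrow> 'a conn set \<Rightarrow> bool" where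
  "special_family A m e S \<longleftrightarrow>
     F_manifold A m e \<and>
     (\<exists>D. connection A D \<and> torsion_free A D \<and> compatible_conn A m D \<and>
          S = {shift_conn A m D V | V. V \<in> vfields A})"

definition dual_conn ::
    "('a, 'e::real_normed_vector) atlas \<Rightarrow> 'a tmult \<Rightarrow> 'a vfield \<Rightarrow> 'a vfield \<Rightarrow>
      'a conn \<Rightarrow> 'a vfield \<Rightarrow> 'a conn" where
  "dual_conn A m e E D W =
     (let E' = inverse_field A m e E; ms = dual_mult A m e E in
      (\<lambda>X\<in>vfields A. \<lambda>Y\<in>vfields A.
        E \<odot>\<^bsub>m\<^esub> D X (E' \<odot>\<^bsub>m\<^esub> Y) - D (E' \<odot>\<^bsub>m\<^esub> Y) E \<odot>\<^bsub>m\<^esub> X + W \<odot>\<^bsub>ms\<^esub> X \<odot>\<^bsub>ms\<^esub> Y))"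

text \<open>
  Every \<open>D \<in> S\<close> yields the same set of connections, so the union over \<open>D\<close> taken here is the
  dual family computed from any one of them.
\<close>

definition dual_family ::
    "('a, 'e::real_normed_vector) atlas \<Rightarrow> 'a tmult \<Rightarrow> 'a vfield \<Rightarrow> 'a vfield \<Rightarrow>
      'a conn set \<Rightarrow> 'a conn set" where
  "dual_family A m e E S = {dual_conn A m e E D W | D W. D \<in> S \<and> W \<in> vfields A}"

section \<open>Legendre fields and Legendre transformations\<close>

definition legendre_field ::
    "('a::{t2_space,second_countable_topology}, 'e::real_normed_vector) atlas \<Rightarrow>
      'a tmult \<Rightarrow> 'a vfield \<Rightarrow> 'a conn set \<Rightarrow> 'a vfield \<Rightarrow> bool" where
  "legendre_field A m e S u \<longleftrightarrow>
     special_family A m e S \<and> invertible_field A m e u \<and>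
     (\<exists>D\<in>S. \<forall>X\<in>vfields A. \<forall>Y\<in>vfields A. D X u \<odot>\<^bsub>m\<^esub> Y = D Y u \<odot>\<^bsub>m\<^esub> X)"

definition legendre_conn ::
    "('a, 'e::real_normed_vector) atlas \<Rightarrow> 'a tmult \<Rightarrow> 'a vfield \<Rightarrow> 'a vfield \<Rightarrow>
      'a conn \<Rightarrow> 'a conn" where
  "legendre_conn A m e u D =
     (\<lambda>X\<in>vfields A. \<lambda>Y\<in>vfields A. inverse_field A m e u \<odot>\<^bsub>m\<^esub> D X (u \<odot>\<^bsub>m\<^esub> Y))"

definition legendre_family ::
    "('a, 'e::real_normed_vector) atlas \<Rightarrow> 'a tmult \<Rightarrow> 'a vfield \<Rightarrow> 'a vfield \<Rightarrow>
      'a conn set \<Rightarrow> 'a conn set" where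
  "legendre_family A m e u S = legendre_conn A m e u ` S"

end

theory Submission
  imports Defs
begin

text \<open>
  Write \<open>D\<close> for the base connection of the special family and \<open>L\<^sub>E\<close> for the Lie derivative.
  Since \<open>E\<close> is the unit of the dual \<open>F\<close>-manifold, \<open>L\<^sub>E(*) = 0\<close>; in terms of the original
  multiplication this says \<open>L\<^sub>E(\<circ>)(X, Y) = [e, E] \<circ> X \<circ> Y\<close>, and with the Hertling--Manin identity
  multiplication by \<open>E\<close> has vanishing Nijenhuis torsion. The latter makes the dual connection
  torsion-free, the former makes it compatible with \<open>*\<close>. For the Legendre field \<open>u\<close>, compatibility
  and torsion-freeness give \<open>D\<^sub>Y(u \<circ> E) = D\<^bsub>u \<circ> Y\<^esub>(E) + q \<circ> Y\<close> with
  \<open>q = [E, u] + [e, E] \<circ> u\<close>. These are the only terms in which the Legendre transform of the dual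
  connection and the dual of the Legendre transform differ, so they differ by a shift within the special family.
\<close>

section \<open>Smooth functions and vector fields\<close>

text \<open>Openness of \<open>S\<close> lets agreement on \<open>S\<close> pass to Frechet
  derivatives. This is needed because the sum and product rules identify the derivatives only at
  points of \<open>S\<close>.\<close>

lemma Ck_on_cong:
  assumes "open S" "\<And>x. x \<in> S \<Longrightarrow> f x = g x" "Ck_on k S f"
  shows "Ck_on k S g"
  using assms(2,3)
proof (induction k arbitrary: f g)
  case 0
  then show ?case by (simp cong: continuous_on_cong)
next
  case (Suc k)
  have der: "(g has_derivative frechet_derivative f (at x)) (at x)" if "x \<in> S" for x
    using has_derivative_transform_within_open[of f _ x UNIV S g] Suc.prems assms(1) that
    by (simp add: frechet_derivative_works)
  have eq: "frechet_derivative f (at x) = frechet_derivative g (at x)" if "x \<in> S" for x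
    by (rule frechet_derivative_at[OF der[OF that]])
  have "Ck_on k S (\<lambda>x. frechet_derivative g (at x) v)" for v
    by (rule Suc.IH[of "\<lambda>x. frechet_derivative f (at x) v"]) (use Suc.prems eq in auto)
  with der show ?case
    unfolding Ck_on.simps differentiable_def by blast
qed

lemma Ck_on_SucD: "Ck_on (Suc k) S f \<Longrightarrow> Ck_on k S f"
proof (induction k arbitrary: f)
  case 0
  then show ?case
    by (auto intro!: differentiable_imp_continuous_on
        simp: differentiable_on_def differentiable_at_withinI)
next
  case (Suc k)
  then show ?case by (metis Ck_on.simps(2))
qed

lemma Ck_on_const: "Ck_on k S (\<lambda>x. c)"
  by (induction k arbitrary: c) auto

lemma Ck_on_add:
  assumes "open S" "Ck_on k S f" "Ck_on k S g"
  shows "Ck_on k S (\<lambda>x. f x + g x)"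
  using assms(2,3)
proof (induction k arbitrary: f g)
  case 0
  then show ?case by (simp add: continuous_on_add)
next
  case (Suc k)
  have "frechet_derivative (\<lambda>x. f x + g x) (at x) =
      (\<lambda>v. frechet_derivative f (at x) v + frechet_derivative g (at x) v)" if "x \<in> S" for x
    using Suc.prems that
    by (intro frechet_derivative_at[symmetric] has_derivative_add)
      (auto simp: frechet_derivative_works[symmetric])
  then show ?case using Suc
    by (auto intro: Ck_on_cong[OF assms(1) _ Suc.IH])
qed

text \<open>The Leibniz rule writes the derivative as a sum of products. Their undifferentiated
  factors are lowered by one order with \<open>Ck_on_SucD\<close>, so that the induction hypothesis
  applies to each product.\<close>

lemma Ck_on_mult:
  fixes f g :: "_ \<Rightarrow> 'b::real_normed_algebra"
  assumes "open S" "Ck_on k S f" "Ck_on k S g"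
  shows "Ck_on k S (\<lambda>x. f x * g x)"
  using assms(2,3)
proof (induction k arbitrary: f g)
  case 0
  then show ?case by (simp add: continuous_on_mult)
next
  case (Suc k)
  have "frechet_derivative (\<lambda>x. f x * g x) (at x) =
      (\<lambda>v. f x * frechet_derivative g (at x) v + frechet_derivative f (at x) v * g x)"
    if "x \<in> S" for x
    using Suc.prems that
    by (intro frechet_derivative_at[symmetric] has_derivative_mult)
      (auto simp: frechet_derivative_works[symmetric])
  moreover have "Ck_on k S f" "Ck_on k S g"
    using Suc.prems by (auto intro: Ck_on_SucD)
  ultimately show ?case using Suc
    by (auto intro: Ck_on_cong[OF assms(1) _ Ck_on_add[OF assms(1) Suc.IH Suc.IH]])
qed

lemma smooth_funs_const: "(\<lambda>q. c) \<in> smooth_funs A"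
  by (auto simp: smooth_funs_def smooth_on_def o_def Ck_on_const)

lemma smooth_funs_add:
  assumes "smooth_manifold A" "f \<in> smooth_funs A" "g \<in> smooth_funs A"
  shows "(\<lambda>q. f q + g q) \<in> smooth_funs A"
  using assms unfolding smooth_manifold_def smooth_funs_def smooth_on_def o_def
  by (fast intro: Ck_on_add)

lemma smooth_funs_mult:
  assumes "smooth_manifold A" "f \<in> smooth_funs A" "g \<in> smooth_funs A"
  shows "(\<lambda>q. f q * g q) \<in> smooth_funs A"
  using assms unfolding smooth_manifold_def smooth_funs_def smooth_on_def o_def
  by (fast intro: Ck_on_mult)

section \<open>Vector fields as a module over the smooth functions\<close>

lemma tangent_space_add:
  assumes "v \<in> tangent_space A p" "w \<in> tangent_space A p"
  shows "v + w \<in> tangent_space A p"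
  using assms by (simp add: tangent_space_def algebra_simps)

lemma tangent_space_tscale: "v \<in> tangent_space A p \<Longrightarrow> tscale c v \<in> tangent_space A p"
  by (simp add: tangent_space_def tscale_def algebra_simps)

lemma vfields_add:
  assumes "smooth_manifold A" "X \<in> vfields A" "Y \<in> vfields A"
  shows "X + Y \<in> vfields A"
  using assms smooth_funs_add[OF assms(1)]
  by (auto simp: vfields_def deriv_along_def tangent_space_add)

lemma vfields_fscale:
  assumes "smooth_manifold A" "f \<in> smooth_funs A" "X \<in> vfields A"
  shows "fscale f X \<in> vfields A"
proof -
  have "(\<lambda>p. f p * X p g) \<in> smooth_funs A" if "g \<in> smooth_funs A" for g
    using assms smooth_funs_mult[OF assms(1,2), of "deriv_along X g"] that
    by (simp add: vfields_def deriv_along_def)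
  then show ?thesis using assms
    by (auto simp: vfields_def deriv_along_def fscale_def tangent_space_tscale)
      (simp add: tscale_def)
qed

lemma vfields_uminus:
  assumes "smooth_manifold A" "X \<in> vfields A"
  shows "- X \<in> vfields A"
proof -
  have "- X = fscale (\<lambda>q. -1) X"
    by (simp add: fun_eq_iff fscale_def tscale_def)
  then show ?thesis
    using vfields_fscale[OF assms(1) smooth_funs_const assms(2)] by simp
qed

lemma fscale_diff: "fscale f (X - Y) = fscale f X - fscale f Y"
  by (auto simp: fscale_def tscale_def fun_eq_iff algebra_simps)

lemma vfields_tangent: "X \<in> vfields A \<Longrightarrow> X p \<in> tangent_space A p"
  by (simp add: vfields_def)

lemma fscale_vmult:
  assumes "tangent_mult A m" "X \<in> vfields A" "Y \<in> vfields A"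
  shows "fscale f X \<odot>\<^bsub>m\<^esub> Y = fscale f (X \<odot>\<^bsub>m\<^esub> Y)"
    and "X \<odot>\<^bsub>m\<^esub> fscale f Y = fscale f (X \<odot>\<^bsub>m\<^esub> Y)"
  using assms vfields_tangent[OF assms(2)] vfields_tangent[OF assms(3)]
  unfolding tangent_mult_def vmult_def fscale_def by (simp_all add: fun_eq_iff)

section \<open>The algebra of an eventual identity\<close>

text \<open>Vector fields fill only part of their function type, hence the carrier \<open>V\<close>.
  The same structure is used for both multiplications, with units \<open>e\<close> and
  \<open>E\<close>.\<close>

locale comm_algebra_on =
  fixes V :: "'b::ab_group_add set" and mult :: "'b \<Rightarrow> 'b \<Rightarrow> 'b" (infixl "\<star>" 70) and e :: 'b
  assumes add_closed [simp]: "x \<in> V \<Longrightarrow> y \<in> V \<Longrightarrow> x + y \<in> V"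
    and uminus_closed [simp]: "x \<in> V \<Longrightarrow> - x \<in> V"
    and mult_closed [simp]: "x \<in> V \<Longrightarrow> y \<in> V \<Longrightarrow> x \<star> y \<in> V"
    and mult_assoc: "x \<in> V \<Longrightarrow> y \<in> V \<Longrightarrow> z \<in> V \<Longrightarrow> x \<star> y \<star> z = x \<star> (y \<star> z)"
    and mult_comm: "x \<in> V \<Longrightarrow> y \<in> V \<Longrightarrow> x \<star> y = y \<star> x"
    and mult_add_left: "x \<in> V \<Longrightarrow> y \<in> V \<Longrightarrow> z \<in> V \<Longrightarrow> (x + y) \<star> z = x \<star> z + y \<star> z"
    and unit_closed [simp]: "e \<in> V"
    and unit_left [simp]: "x \<in> V \<Longrightarrow> e \<star> x = x"
begin

lemma diff_closed [simp]: "x \<in> V \<Longrightarrow> y \<in> V \<Longrightarrow> x - y \<in> V"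
  using add_closed[of x "- y"] by simp

lemma zero_closed [simp]: "0 \<in> V"
  using diff_closed[of e e] by simp

lemma unit_right [simp]: "x \<in> V \<Longrightarrow> x \<star> e = x"
  by (simp add: mult_comm[of x])

lemma mult_left_comm: "x \<in> V \<Longrightarrow> y \<in> V \<Longrightarrow> z \<in> V \<Longrightarrow> x \<star> (y \<star> z) = y \<star> (x \<star> z)"
  by (metis mult_assoc mult_comm)

lemmas mult_ac = mult_assoc mult_comm mult_left_comm

lemma mult_add_right: "x \<in> V \<Longrightarrow> y \<in> V \<Longrightarrow> z \<in> V \<Longrightarrow> z \<star> (x + y) = z \<star> x + z \<star> y"
  by (simp add: mult_add_left mult_comm[of z])

lemma mult_zero_left [simp]: "x \<in> V \<Longrightarrow> 0 \<star> x = 0"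
  using mult_add_left[of 0 0 x] by simp

lemma mult_zero_right [simp]: "x \<in> V \<Longrightarrow> x \<star> 0 = 0"
  by (simp add: mult_comm[of x])

lemma mult_minus_left: "x \<in> V \<Longrightarrow> y \<in> V \<Longrightarrow> (- x) \<star> y = - (x \<star> y)"
  using mult_add_left[of x "- x" y] by (simp add: eq_neg_iff_add_eq_0 add.commute)

lemma mult_minus_right: "x \<in> V \<Longrightarrow> y \<in> V \<Longrightarrow> x \<star> (- y) = - (x \<star> y)"
  by (simp add: mult_comm[of x] mult_minus_left)

lemma mult_diff_left: "x \<in> V \<Longrightarrow> y \<in> V \<Longrightarrow> z \<in> V \<Longrightarrow> (x - y) \<star> z = x \<star> z - y \<star> z"
  using mult_add_left[of x "- y" z] by (simp add: mult_minus_left)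

lemma mult_diff_right: "x \<in> V \<Longrightarrow> y \<in> V \<Longrightarrow> z \<in> V \<Longrightarrow> z \<star> (x - y) = z \<star> x - z \<star> y"
  by (simp add: mult_diff_left mult_comm[of z])

lemmas ring_simps = mult_add_left mult_add_right mult_minus_left mult_minus_right
  mult_diff_left mult_diff_right mult_ac

lemma inverse_cancel:
  "x \<in> V \<Longrightarrow> x' \<in> V \<Longrightarrow> x \<star> x' = e \<Longrightarrow> y \<in> V \<Longrightarrow> x \<star> (x' \<star> y) = y"
  by (metis mult_assoc unit_left)

lemma inverse_unique:
  assumes "x \<in> V" "y \<in> V" "z \<in> V" "x \<star> y = e" "x \<star> z = e"
  shows "y = z"
  by (metis assms mult_assoc mult_comm unit_left)

end

text \<open>\<open>L\<close> models the Lie bracket. The assumption \<open>eventual\<close> says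
  that \<open>L E\<close> is a derivation of the dual product, evaluated on
  \<open>E \<star> x\<close> and \<open>E \<star> y\<close>, whose dual product is
  \<open>E \<star> (x \<star> y)\<close>. \<open>L_self\<close> is separate from
  \<open>L_skew\<close> because an abelian group may have 2-torsion.\<close>

locale eventual_identity_algebra = comm_algebra_on +
  fixes L :: "'a::ab_group_add \<Rightarrow> 'a \<Rightarrow> 'a" and E E' :: 'a
  assumes L_closed [simp]: "x \<in> V \<Longrightarrow> y \<in> V \<Longrightarrow> L x y \<in> V"
    and L_skew: "L x y = - L y x" and L_self [simp]: "L x x = 0"
    and hertling_manin: "\<lbrakk>x \<in> V; y \<in> V; z \<in> V; w \<in> V\<rbrakk> \<Longrightarrow>
        L (x \<star> y) (z \<star> w) - L (x \<star> y) z \<star> w - z \<star> L (x \<star> y) w =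
        x \<star> (L y (z \<star> w) - L y z \<star> w - z \<star> L y w) + y \<star> (L x (z \<star> w) - L x z \<star> w - z \<star> L x w)"
    and E_closed [simp]: "E \<in> V" and E'_closed [simp]: "E' \<in> V"
    and E_inverse [simp]: "E \<star> E' = e"
    and eventual: "x \<in> V \<Longrightarrow> y \<in> V \<Longrightarrow>
        L E (E \<star> (x \<star> y)) = L E (E \<star> x) \<star> y + x \<star> L E (E \<star> y)"
begin

lemma E_cancel [simp]: "x \<in> V \<Longrightarrow> E \<star> (E' \<star> x) = x" "x \<in> V \<Longrightarrow> E' \<star> (E \<star> x) = x"
  using inverse_cancel[of E E' x] by (simp_all add: mult_left_comm[of E'])

lemma L_E_mult:
  assumes "x \<in> V" "y \<in> V"
  shows "L E (x \<star> y) = L E x \<star> y + x \<star> L E y - L E e \<star> (x \<star> y)"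
proof -
  \<comment> \<open>Taking \<open>E'\<close> as the first factor in \<open>eventual\<close> relates
    \<open>L E (E \<star> z)\<close> to \<open>L E z\<close>, so that every bracket can be freed of
    the extra factor \<open>E\<close>.\<close>
  have *: "L E z = L E e \<star> z + E' \<star> L E (E \<star> z)" if "z \<in> V" for z
    using eventual[of E' z] that by simp
  have "E \<star> L E y = E \<star> (L E e \<star> y) + L E (E \<star> y)"
    using assms by (subst *) (simp_all add: ring_simps)
  then have b: "L E (E \<star> y) = E \<star> L E y - E \<star> (L E e \<star> y)"
    by (simp add: algebra_simps)
  have "L E (x \<star> y) = L E x \<star> y + E' \<star> x \<star> L E (E \<star> y)"
    using eventual[of "E' \<star> x" y] assms by (simp add: mult_assoc)
  then show ?thesis
    using assms by (simp add: b ring_simps)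
qed

text \<open>Apply \<open>hertling_manin\<close> to the products \<open>E \<star> x\<close> and
  \<open>E \<star> y\<close> and evaluate the brackets with \<open>E\<close> by
  \<open>L_E_mult\<close>. All terms containing \<open>L E e\<close> or \<open>L E x\<close> then
  cancel.\<close>

lemma L_nijenhuis:
  assumes "x \<in> V" "y \<in> V"
  shows "L (E \<star> x) (E \<star> y) = E \<star> (L (E \<star> x) y + L x (E \<star> y) - E \<star> L x y)"
proof -
  have 1: "L E (E \<star> z) = E \<star> L E z - L E e \<star> (E \<star> z)" if "z \<in> V" for z
    using that by (simp add: L_E_mult)
  have 2: "L (E \<star> x) E = L E e \<star> (E \<star> x) - E \<star> L E x"
    using assms by (subst L_skew) (simp add: 1)
  have 3: "L x E = - L E x" by (rule L_skew)
  have "L (E \<star> x) (E \<star> y) = L (E \<star> x) E \<star> y + E \<star> L (E \<star> x) y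
      + E \<star> (L x (E \<star> y) - L x E \<star> y - E \<star> L x y) + x \<star> (L E (E \<star> y) - E \<star> L E y)"
    using hertling_manin[of E x E y] assms by (simp add: algebra_simps)
  then show ?thesis
    using assms by (simp add: 1 2 3 ring_simps)
qed

end

section \<open>Torsion-free compatible connections and their duals\<close>

locale connection_algebra = eventual_identity_algebra +
  fixes D :: "'a::ab_group_add \<Rightarrow> 'a \<Rightarrow> 'a"
  assumes D_closed [simp]: "x \<in> V \<Longrightarrow> y \<in> V \<Longrightarrow> D x y \<in> V"
    and D_torsion: "x \<in> V \<Longrightarrow> y \<in> V \<Longrightarrow> D x y - D y x = L x y"
    and D_compatible: "\<lbrakk>x \<in> V; y \<in> V; z \<in> V\<rbrakk> \<Longrightarrow>
        D x (y \<star> z) - D x y \<star> z - y \<star> D x z = D y (x \<star> z) - D y x \<star> z - x \<star> D y z"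
begin

text \<open>The covariant derivative of the multiplication, totally symmetric by
  \<open>C_swap\<close> and \<open>C_commute\<close>.\<close>

definition C :: "'a \<Rightarrow> 'a \<Rightarrow> 'a \<Rightarrow> 'a" where
  "C x y z = D x (y \<star> z) - D x y \<star> z - y \<star> D x z"

lemma C_closed [simp]: "x \<in> V \<Longrightarrow> y \<in> V \<Longrightarrow> z \<in> V \<Longrightarrow> C x y z \<in> V"
  by (simp add: C_def)

lemma C_swap: "x \<in> V \<Longrightarrow> y \<in> V \<Longrightarrow> z \<in> V \<Longrightarrow> C x y z = C y x z"
  using D_compatible by (simp add: C_def)

lemma C_commute: "x \<in> V \<Longrightarrow> y \<in> V \<Longrightarrow> z \<in> V \<Longrightarrow> C x y z = C x z y"
  by (simp add: C_def ring_simps)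

lemma D_mult: "x \<in> V \<Longrightarrow> y \<in> V \<Longrightarrow> z \<in> V \<Longrightarrow> D x (y \<star> z) = C x y z + D x y \<star> z + y \<star> D x z"
  by (simp add: C_def)

text \<open>For fixed \<open>w\<close>, up to sign, \<open>C w\<close> is the Hochschild coboundary
  of \<open>D w\<close>, hence a 2-cocycle; this is associativity of the product.\<close>

lemma C_cocycle:
  assumes "w \<in> V" "x \<in> V" "y \<in> V" "z \<in> V"
  shows "C w (x \<star> y) z + C w x y \<star> z = C w x (y \<star> z) + x \<star> C w y z"
  using assms by (simp add: C_def ring_simps algebra_simps)

text \<open>The member of the dual family with shift field 0.\<close>

definition dual :: "'a \<Rightarrow> 'a \<Rightarrow> 'a" where
  "dual x y = E \<star> D x (E' \<star> y) - D (E' \<star> y) E \<star> x"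

lemma dual_closed [simp]: "x \<in> V \<Longrightarrow> y \<in> V \<Longrightarrow> dual x y \<in> V"
  by (simp add: dual_def)

lemma dual_E: "x \<in> V \<Longrightarrow> y \<in> V \<Longrightarrow> dual x (E \<star> y) = E \<star> D x y - D y E \<star> x"
  by (simp add: dual_def)

lemma D_swap: "x \<in> V \<Longrightarrow> y \<in> V \<Longrightarrow> D x y = D y x + L x y"
  using D_torsion[of x y] by (simp add: algebra_simps)

text \<open>Since \<open>E\<close> is invertible, arguments of the form \<open>E \<star> x\<close>
  and \<open>E \<star> y\<close> suffice. The term \<open>C y E x\<close> is symmetric in
  \<open>x\<close> and \<open>y\<close> and drops out; what remains is the right-hand side of
  \<open>L_nijenhuis\<close>.\<close>

lemma dual_torsion:
  assumes "x \<in> V" "y \<in> V"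
  shows "dual x y - dual y x = L x y"
proof -
  have *: "dual (E \<star> x) (E \<star> y) = E \<star> (L (E \<star> x) y + C y E x + E \<star> D y x)"
    if "x \<in> V" "y \<in> V" for x y
  proof -
    have "D (E \<star> x) y = C y E x + D y E \<star> x + E \<star> D y x + L (E \<star> x) y"
      using that by (subst D_swap) (simp_all add: D_mult)
    then show ?thesis
      using that by (simp add: dual_E ring_simps algebra_simps)
  qed
  have **: "dual (E \<star> x) (E \<star> y) - dual (E \<star> y) (E \<star> x) = L (E \<star> x) (E \<star> y)"
    if "x \<in> V" "y \<in> V" for x y
  proof -
    have 1: "C x E y = C y E x"
      using that by (metis C_swap C_commute E_closed)
    have 2: "L (E \<star> y) x = - L x (E \<star> y)" by (rule L_skew)
    show ?thesis
      using that by (simp add: * 1 2 L_nijenhuis D_swap[of x y] ring_simps)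
  qed
  show ?thesis using **[of "E' \<star> x" "E' \<star> y"] assms by simp
qed

text \<open>Torsion-freeness trades \<open>D (y \<star> z) E\<close> for
  \<open>D E (y \<star> z)\<close> and \<open>L E (y \<star> z)\<close>, both of which have product
  rules. The result measures how far \<open>D _ E\<close> is from being a derivation.\<close>

lemma D_E_mult:
  assumes "y \<in> V" "z \<in> V"
  shows "D (y \<star> z) E = D y E \<star> z + y \<star> D z E + C E y z + L E e \<star> (y \<star> z)"
proof -
  have "D (y \<star> z) E = D E (y \<star> z) - L E (y \<star> z)"
    using D_swap[of E "y \<star> z"] assms by simp
  also have "\<dots> = C E y z + D E y \<star> z + y \<star> D E z
      - (L E y \<star> z + y \<star> L E z - L E e \<star> (y \<star> z))"
    using assms by (simp add: D_mult L_E_mult)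
  finally show ?thesis
    using assms by (simp add: D_swap[of E y] D_swap[of E z] ring_simps algebra_simps)
qed

lemma dual_compatible:
  assumes "x \<in> V" "y \<in> V" "z \<in> V"
  shows "dual x (y \<star> z \<star> E') - dual x y \<star> z \<star> E' - y \<star> dual x z \<star> E' =
    dual y (x \<star> z \<star> E') - dual y x \<star> z \<star> E' - x \<star> dual y z \<star> E'"
proof -
  \<comment> \<open>After \<open>C_cocycle\<close> has moved the factor \<open>E\<close> out of the
    first argument of \<open>C\<close>, the defect of the dual connection is visibly symmetric in
    \<open>x\<close> and \<open>y\<close>.\<close>
  have expand: "dual (E \<star> x) (E \<star> (y \<star> z)) - dual (E \<star> x) (E \<star> y) \<star> z - y \<star> dual (E \<star> x) (E \<star> z) =
      E \<star> (C y x (E \<star> z) - C y x E \<star> z - L E e \<star> (x \<star> (y \<star> z)))"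
    if "x \<in> V" "y \<in> V" "z \<in> V" for x y z
  proof -
    have "C (E \<star> x) y z = C y (x \<star> E) z"
      using that by (simp add: C_swap[of y] mult_comm[of E])
    also have "\<dots> = C y x (E \<star> z) + x \<star> C E y z - C y x E \<star> z"
      using C_cocycle[of y x E z] that by (simp add: algebra_simps C_swap[of y E])
    finally have "C (E \<star> x) y z = C y x (E \<star> z) + x \<star> C E y z - C y x E \<star> z" .
    then show ?thesis
      using that by (simp add: dual_E D_mult D_E_mult ring_simps)
  qed
  define x1 y1 z1 where "x1 = E' \<star> x" "y1 = E' \<star> y" "z1 = E' \<star> z"
  have V: "x1 \<in> V" "y1 \<in> V" "z1 \<in> V" using assms by (auto simp: x1_y1_z1_def)
  have eq: "x = E \<star> x1" "y = E \<star> y1" "z = E \<star> z1" using assms by (auto simp: x1_y1_z1_def)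
  have lhs: "dual a (b \<star> c \<star> E') - dual a b \<star> c \<star> E' - b \<star> dual a c \<star> E' =
    dual a (E \<star> (b1 \<star> c1)) - dual a b \<star> c1 - b1 \<star> dual a c"
    if "a \<in> V" "b1 \<in> V" "c1 \<in> V" "b = E \<star> b1" "c = E \<star> c1" for a b c b1 c1
    using that by (simp add: ring_simps)
  have "C y1 x1 w = C x1 y1 w" if "w \<in> V" for w
    using V that by (simp add: C_swap)
  then show ?thesis
    using V by (simp add: eq lhs[of _ y1 z1] lhs[of _ x1 z1] expand)
      (simp add: mult_left_comm[of x1])
qed

section \<open>Legendre fields in the abstract algebra\<close>

context
  fixes u :: 'a
  assumes u [simp]: "u \<in> V"
    and legendre: "\<And>x y. x \<in> V \<Longrightarrow> y \<in> V \<Longrightarrow> D x u \<star> y = D y u \<star> x"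
begin

text \<open>By \<open>dual_E\<close> the left side is
  \<open>E \<star> D x u \<star> y - D u E \<star> x \<star> y\<close>: the first term is symmetric
  by the Legendre condition, the second by commutativity.\<close>

lemma dual_legendre:
  assumes "x \<in> V" "y \<in> V"
  shows "dual x (E \<star> u) \<star> y = dual y (E \<star> u) \<star> x"
  using assms legendre[of x y] by (simp add: dual_E ring_simps)

text \<open>The factor of \<open>y\<close> is the vector field by which the two families are shifted against each other.\<close>

lemma D_legendre_E:
  assumes "y \<in> V"
  shows "D y (u \<star> E) = D (u \<star> y) E + (L E u - L E e \<star> u) \<star> y"
proof -
  have "D y (u \<star> E) = C E u y + D y u \<star> E + u \<star> D y E"
    using assms by (simp add: D_mult) (metis C_swap C_commute E_closed u)
  also have "D y u \<star> E = D E u \<star> y"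
    using legendre[of y E] assms by simp
  also have "D E u = D u E + L E u"
    by (simp add: D_swap[of E u])
  finally show ?thesis
    using assms by (simp add: D_E_mult ring_simps algebra_simps)
qed

end

end

section \<open>Duality of special families\<close>

lemma F_manifold_comm_algebra:
  assumes "F_manifold A m e"
  shows "comm_algebra_on (vfields A) (\<lambda>X Y. X \<odot>\<^bsub>m\<^esub> Y) e"
proof -
  have A: "smooth_manifold A" "tangent_mult A m" "unit_field A m e"
    using assms by (auto simp: F_manifold_def)
  have T: "m p (m p u v) w = m p u (m p v w)" "m p u v = m p v u"
    "m p (u + v) w = m p u w + m p v w"
    if "u \<in> tangent_space A p" "v \<in> tangent_space A p" "w \<in> tangent_space A p" for p u v w
    using A(2) that unfolding tangent_mult_def by blast+
  show ?thesis
  proof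
    fix X Y Z assume *: "X \<in> vfields A" "Y \<in> vfields A" "Z \<in> vfields A"
    note t = *[THEN vfields_tangent]
    show "X \<odot>\<^bsub>m\<^esub> Y \<odot>\<^bsub>m\<^esub> Z = X \<odot>\<^bsub>m\<^esub> (Y \<odot>\<^bsub>m\<^esub> Z)"
      "(X + Y) \<odot>\<^bsub>m\<^esub> Z = X \<odot>\<^bsub>m\<^esub> Z + Y \<odot>\<^bsub>m\<^esub> Z"
      unfolding vmult_def plus_fun_def using T(1,3)[OF t, unfolded plus_fun_def] by auto
  next
    fix X Y assume *: "X \<in> vfields A" "Y \<in> vfields A"
    note t = *[THEN vfields_tangent]
    show "X \<odot>\<^bsub>m\<^esub> Y = Y \<odot>\<^bsub>m\<^esub> X"
      unfolding vmult_def using T(2)[OF t t(1)] by auto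
    show "X \<odot>\<^bsub>m\<^esub> Y \<in> vfields A"
      using A(2) * by (simp add: tangent_mult_def)
  qed (use A in \<open>auto simp: vfields_add vfields_uminus unit_field_def vmult_def vfields_tangent\<close>)
qed

lemma inverse_field_eq:
  assumes "F_manifold A m e" "X \<in> vfields A" "Y \<in> vfields A" "X \<odot>\<^bsub>m\<^esub> Y = e"
  shows "inverse_field A m e X = Y"
  unfolding inverse_field_def
  using comm_algebra_on.inverse_unique[OF F_manifold_comm_algebra[OF assms(1)] assms(2)] assms
  by (intro the_equality) blast+

lemma dual_vmult:
  "X \<odot>\<^bsub>dual_mult A m e E\<^esub> Y = X \<odot>\<^bsub>m\<^esub> Y \<odot>\<^bsub>m\<^esub> inverse_field A m e E"
  by (simp add: vmult_def dual_mult_def)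

text \<open>\<open>dual_family\<close> collects the duals of all members of \<open>S\<close>. If
  these do not depend on the member, any single one yields the whole family; the inclusion from
  right to left takes one from the nonempty \<open>S\<close>.\<close>

lemma dual_family_eq_image:
  assumes "S \<noteq> {}"
    and K: "\<And>F W. F \<in> S \<Longrightarrow> W \<in> vfields A \<Longrightarrow> dual_conn A m e E F W = K W"
  shows "dual_family A m e E S = K ` vfields A"
proof
  show "dual_family A m e E S \<subseteq> K ` vfields A"
    using K by (auto simp: dual_family_def)
  obtain F where F: "F \<in> S" using assms(1) by blast
  show "K ` vfields A \<subseteq> dual_family A m e E S"
  proof
    fix N assume "N \<in> K ` vfields A"
    then obtain W where "W \<in> vfields A" "N = dual_conn A m e E F W"
      using K[OF F] by auto
    with F show "N \<in> dual_family A m e E S"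
      unfolding dual_family_def by blast
  qed
qed

text \<open>The parameter \<open>E'\<close> names the inverse of \<open>E\<close>, so that the
  definite description in \<open>inverse_field\<close> is rewritten to a variable.\<close>

locale eventual_duality =
  fixes A :: "('a::{t2_space,second_countable_topology}, 'e::real_normed_vector) atlas"
    and m :: "'a tmult" and e E E' :: "'a vfield" and D :: "'a conn"
  assumes eventual_identity: "eventual_identity A m e E"
    and inverse_E [simp]: "inverse_field A m e E = E'"
    and connection: "connection A D"
    and torsion_free: "torsion_free A D"
    and compatible: "compatible_conn A m D"
begin

abbreviation "V \<equiv> vfields A"
abbreviation vmult_m (infixl "\<star>" 70) where "X \<star> Y \<equiv> X \<odot>\<^bsub>m\<^esub> Y"
abbreviation "m' \<equiv> dual_mult A m e E"
abbreviation "D' \<equiv> dual_conn A m e E D 0"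

lemma F_manifolds: "F_manifold A m e" "F_manifold A m' E"
  using eventual_identity by (auto simp: eventual_identity_def)

lemma smooth_manifold: "smooth_manifold A" and tangent_mult: "tangent_mult A m"
  using F_manifolds by (auto simp: F_manifold_def)

sublocale m': comm_algebra_on V "\<lambda>X Y. X \<odot>\<^bsub>m'\<^esub> Y" E
  by (rule F_manifold_comm_algebra[OF F_manifolds(2)])

sublocale comm_algebra_on V "\<lambda>X Y. X \<odot>\<^bsub>m\<^esub> Y" e
  by (rule F_manifold_comm_algebra[OF F_manifolds(1)])

lemma E_inverse: "E \<in> V" "E' \<in> V" "E \<star> E' = e"
proof -
  obtain Y where Y: "E \<in> V" "Y \<in> V" "E \<star> Y = e"
    using eventual_identity unfolding eventual_identity_def invertible_field_def by blast
  have "E' = Y"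
    using inverse_field_eq[OF F_manifolds(1) Y] by simp
  with Y show "E \<in> V" "E' \<in> V" "E \<star> E' = e" by auto
qed

lemma D_in [simp]: "X \<in> V \<Longrightarrow> Y \<in> V \<Longrightarrow> D X Y \<in> V"
  using connection by (auto simp: connection_def)

lemma D_diff: "X \<in> V \<Longrightarrow> Y \<in> V \<Longrightarrow> D X Y - D Y X = lie_bracket X Y"
  using torsion_free by (simp add: torsion_free_def)

text \<open>\<open>E\<close> is the unit of \<open>m'\<close>, so the Hertling--Manin identity of \<open>m'\<close> at \<open>E = E * E\<close> reads
  \<open>L\<^sub>E(*) = 2 L\<^sub>E(*)\<close>.\<close>

lemma lie_bracket_E_dual:
  assumes "X \<in> V" "Y \<in> V"
  shows "lie_bracket E (X \<odot>\<^bsub>m'\<^esub> Y) = lie_bracket E X \<odot>\<^bsub>m'\<^esub> Y + X \<odot>\<^bsub>m'\<^esub> lie_bracket E Y"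
proof -
  \<comment> \<open>The bracket is a vector field because torsion-freeness writes it as a difference
    of two covariant derivatives.\<close>
  have L: "lie_bracket E Z \<in> V" if "Z \<in> V" for Z
    using D_diff[of E Z] E_inverse that by (metis D_in diff_closed)
  have "lie_deriv_mult m' E X Y \<in> V"
    unfolding lie_deriv_mult_def using assms by (simp add: L)
  moreover have "lie_deriv_mult m' (E \<odot>\<^bsub>m'\<^esub> E) X Y =
      E \<odot>\<^bsub>m'\<^esub> lie_deriv_mult m' E X Y + E \<odot>\<^bsub>m'\<^esub> lie_deriv_mult m' E X Y"
    using F_manifolds(2) assms E_inverse(1) unfolding F_manifold_def by blast
  ultimately have "lie_deriv_mult m' E X Y = 0"
    using E_inverse(1) by simp
  then show ?thesis
    by (simp add: lie_deriv_mult_def algebra_simps)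
qed

sublocale connection_algebra V "\<lambda>X Y. X \<odot>\<^bsub>m\<^esub> Y" e lie_bracket E E' D
proof unfold_locales
  show "lie_bracket X Y \<in> V" if "X \<in> V" "Y \<in> V" for X Y
    using that by (metis D_diff D_in diff_closed)
  show "lie_bracket X Y = - lie_bracket Y X" "lie_bracket X X = 0" for X Y :: "'a vfield"
    by (simp_all add: lie_bracket_def fun_eq_iff)
  show "lie_bracket (X \<star> Y) (Z \<star> W) - lie_bracket (X \<star> Y) Z \<star> W - Z \<star> lie_bracket (X \<star> Y) W =
      X \<star> (lie_bracket Y (Z \<star> W) - lie_bracket Y Z \<star> W - Z \<star> lie_bracket Y W) +
      Y \<star> (lie_bracket X (Z \<star> W) - lie_bracket X Z \<star> W - Z \<star> lie_bracket X W)"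
    if "X \<in> V" "Y \<in> V" "Z \<in> V" "W \<in> V" for X Y Z W
    using F_manifolds(1) that unfolding F_manifold_def lie_deriv_mult_def by blast
  show "lie_bracket E (E \<star> (X \<star> Y)) =
      lie_bracket E (E \<star> X) \<star> Y + X \<star> lie_bracket E (E \<star> Y)" if "X \<in> V" "Y \<in> V" for X Y
  proof -
    have cancel: "E \<star> (E' \<star> Z) = Z" if "Z \<in> V" for Z
      using inverse_cancel[OF E_inverse that] .
    have L: "lie_bracket E (E \<star> Z) \<in> V" if "Z \<in> V" for Z
      using D_diff[of E "E \<star> Z"] E_inverse(1) that by (metis D_in diff_closed mult_closed)
    show ?thesis
      \<comment> \<open>On \<open>E \<star> X\<close> and \<open>E \<star> Y\<close> each dual
        product contains a factor \<open>E\<close> that cancels its \<open>E'\<close>.\<close>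
      using lie_bracket_E_dual[of "E \<star> X" "E \<star> Y"] that E_inverse(1,2) L[OF that(1)] L[OF that(2)]
      by (simp add: dual_vmult mult_ac cancel)
  qed
  show "D X Y - D Y X = lie_bracket X Y" if "X \<in> V" "Y \<in> V" for X Y
    using that by (rule D_diff)
  show "D X (Y \<star> Z) - D X Y \<star> Z - Y \<star> D X Z = D Y (X \<star> Z) - D Y X \<star> Z - X \<star> D Y Z"
    if "X \<in> V" "Y \<in> V" "Z \<in> V" for X Y Z
    using compatible that unfolding compatible_conn_def cov_deriv_mult_def by blast
qed (use E_inverse in auto)

lemma D'_eq: "X \<in> V \<Longrightarrow> Y \<in> V \<Longrightarrow> D' X Y = dual X Y"
  by (simp add: dual_conn_def Let_def dual_def dual_vmult)

section \<open>The dual connection and the dual special family\<close>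

lemma fscale_in [simp]: "f \<in> smooth_funs A \<Longrightarrow> X \<in> V \<Longrightarrow> fscale f X \<in> V"
  by (rule vfields_fscale[OF smooth_manifold])

text \<open>In the first term of the dual connection \<open>E\<close> and \<open>E'\<close> cancel
  in front of the Leibniz term, leaving \<open>fscale (deriv_along X f) Y\<close>; the second term
  is linear over the smooth functions in both arguments.\<close>

lemma connection_dual: "connection A D'"
proof -
  have "D' \<in> V \<rightarrow>\<^sub>E (V \<rightarrow>\<^sub>E V)"
    by (simp add: dual_conn_def Let_def dual_vmult)
  moreover have "D' (X + Y) Z = D' X Z + D' Y Z" "D' X (Y + Z) = D' X Y + D' X Z"
    if "X \<in> V" "Y \<in> V" "Z \<in> V" for X Y Z
    using connection that by (simp_all add: D'_eq dual_def connection_def ring_simps)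
  moreover have "D' (fscale f X) Y = fscale f (D' X Y)"
    "D' X (fscale f Y) = fscale (deriv_along X f) Y + fscale f (D' X Y)"
    if "f \<in> smooth_funs A" "X \<in> V" "Y \<in> V" for f X Y
  proof -
    have "deriv_along X f \<in> smooth_funs A"
      using that by (simp add: vfields_def)
    then show "D' (fscale f X) Y = fscale f (D' X Y)"
      "D' X (fscale f Y) = fscale (deriv_along X f) Y + fscale f (D' X Y)"
      using connection that
      by (simp_all add: D'_eq dual_def connection_def ring_simps
          fscale_vmult[OF tangent_mult] fscale_diff)
  qed
  ultimately show ?thesis unfolding connection_def by (intro conjI ballI)
qed

lemma torsion_free_dual: "torsion_free A D'"
  by (simp add: torsion_free_def D'_eq dual_torsion)

lemma compatible_dual: "compatible_conn A m' D'"
  unfolding compatible_conn_def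
proof (intro ballI conjI)
  fix X Y Z assume *: "X \<in> V" "Y \<in> V" "Z \<in> V"
  show "cov_deriv_mult m' D' X Y Z = cov_deriv_mult m' D' Y X Z"
    using * dual_compatible[of X Y Z]
    by (simp add: cov_deriv_mult_def D'_eq dual_vmult)
  show "cov_deriv_mult m' D' X Y Z = cov_deriv_mult m' D' X Z Y"
    using * by (simp add: cov_deriv_mult_def D'_eq m'.mult_comm[of Z] m'.mult_comm[of "dual X Z"])
qed

text \<open>The shift by \<open>Z\<close> enters the two terms of the dual connection as
  \<open>Z \<star> X \<star> Y\<close> with opposite signs, which is why the dual does not depend on
  the chosen member.\<close>

lemma dual_conn_shift:
  assumes "Z \<in> V" "W \<in> V"
  shows "dual_conn A m e E (shift_conn A m D Z) W = shift_conn A m' D' W"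
  using assms
  by (simp add: dual_conn_def shift_conn_def Let_def dual_vmult ring_simps cong: restrict_cong)

lemma dual_family_shift:
  "dual_family A m e E {shift_conn A m D Z |Z. Z \<in> V} = {shift_conn A m' D' W |W. W \<in> V}"
proof -
  have "shift_conn A m D 0 \<in> {shift_conn A m D Z |Z. Z \<in> V}"
    using zero_closed by blast
  then have "dual_family A m e E {shift_conn A m D Z |Z. Z \<in> V} = shift_conn A m' D' ` V"
    by (intro dual_family_eq_image) (auto simp: dual_conn_shift)
  then show ?thesis by (simp add: Setcompr_eq_image)
qed

lemma special_family_dual:
  "special_family A m' E (dual_family A m e E {shift_conn A m D Z |Z. Z \<in> V})"
  unfolding special_family_def dual_family_shift
  using F_manifolds connection_dual torsion_free_dual compatible_dual by blast

section \<open>Legendre transforms of the dual family\<close>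

context
  fixes u u' :: "'a vfield"
  assumes u [simp]: "u \<in> V" "u' \<in> V" and u_inverse: "u \<star> u' = e"
    and legendre: "\<And>X Y. X \<in> V \<Longrightarrow> Y \<in> V \<Longrightarrow> D X u \<star> Y = D Y u \<star> X"
begin

lemma inverse_u: "inverse_field A m e u = u'"
  using inverse_field_eq[OF F_manifolds(1) u u_inverse] .

text \<open>The dual product contributes one factor \<open>E'\<close> and its unit is
  \<open>E\<close>, so the dual inverse of \<open>E \<star> u\<close> is \<open>E \<star> u'\<close>
  rather than \<open>E' \<star> u'\<close>.\<close>

lemma E_u_inverse: "(E \<star> u) \<odot>\<^bsub>m'\<^esub> (E \<star> u') = E"
proof -
  have "u \<star> (u' \<star> X) = X" if "X \<in> V" for X
    using inverse_cancel[OF u u_inverse that] .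
  then show ?thesis
    using u_inverse by (simp add: dual_vmult ring_simps)
qed

lemma legendre_field_dual:
  "legendre_field A m' E (dual_family A m e E {shift_conn A m D Z |Z. Z \<in> V}) (E \<star> u)"
proof -
  have "invertible_field A m' E (E \<star> u)"
    unfolding invertible_field_def using E_u_inverse by auto
  moreover have "shift_conn A m' D' 0 X (E \<star> u) \<odot>\<^bsub>m'\<^esub> Y = shift_conn A m' D' 0 Y (E \<star> u) \<odot>\<^bsub>m'\<^esub> X"
    if "X \<in> V" "Y \<in> V" for X Y
    using that dual_legendre[OF u(1) legendre that]
    by (simp add: shift_conn_def D'_eq dual_vmult)
  moreover have "shift_conn A m' D' 0 \<in> dual_family A m e E {shift_conn A m D Z |Z. Z \<in> V}"
    unfolding dual_family_shift using zero_closed by blast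
  ultimately show ?thesis
    unfolding legendre_field_def using special_family_dual by blast
qed

lemma legendre_family_dual:
  "legendre_family A m' E (E \<star> u) (dual_family A m e E {shift_conn A m D Z |Z. Z \<in> V}) =
    dual_family A m e E (legendre_family A m e u {shift_conn A m D Z |Z. Z \<in> V})"
proof -
  define q where "q = lie_bracket E u - lie_bracket E e \<star> u"
  \<comment> \<open>\<open>K W\<close> is the dual of the Legendre transform of \<open>D\<close>,
    shifted by \<open>W\<close>. Both families are compared with it.\<close>
  define K where "K W = (\<lambda>X\<in>V. \<lambda>Y\<in>V. E \<star> (u' \<star> D X (E' \<star> (Y \<star> u))) -
    u' \<star> D (E' \<star> Y) (E \<star> u) \<star> X + W \<odot>\<^bsub>m'\<^esub> X \<odot>\<^bsub>m'\<^esub> Y)" for W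
  \<comment> \<open>Chosen so that shifting by \<open>r\<close> in the dual product adds
    \<open>u' \<star> q \<star> E' \<star> X \<star> Y\<close>, the discrepancy that
    \<open>key\<close> produces.\<close>
  define r where "r = E \<star> u' \<star> q"
  have [simp]: "q \<in> V" by (simp add: q_def)
  have [simp]: "r \<in> V" by (simp add: r_def)
  have u_cancel: "u \<star> (u' \<star> X) = X" if "X \<in> V" for X
    using inverse_cancel[OF u u_inverse that] .
  have inv: "inverse_field A m' E (E \<star> u) = E \<star> u'"
    using E_u_inverse by (intro inverse_field_eq[OF F_manifolds(2)]) auto
  have key: "D (E' \<star> Y) (E \<star> u) = D (E' \<star> (Y \<star> u)) E + q \<star> (E' \<star> Y)" if "Y \<in> V" for Y
    using D_legendre_E[OF u(1) legendre, of "E' \<star> Y"] that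
    by (simp add: q_def mult_ac)
  have 1: "legendre_conn A m' E (E \<star> u) (shift_conn A m' D' W) = K (W + r)" if "W \<in> V" for W
    unfolding legendre_conn_def K_def inv
  proof (intro restrict_ext)
    fix X Y assume "X \<in> V" "Y \<in> V"
    then show "(E \<star> u') \<odot>\<^bsub>m'\<^esub> shift_conn A m' D' W X ((E \<star> u) \<odot>\<^bsub>m'\<^esub> Y) =
      E \<star> (u' \<star> D X (E' \<star> (Y \<star> u))) - u' \<star> D (E' \<star> Y) (E \<star> u) \<star> X
        + (W + r) \<odot>\<^bsub>m'\<^esub> X \<odot>\<^bsub>m'\<^esub> Y"
      using that
      by (simp add: shift_conn_def D'_eq dual_def dual_vmult key r_def ring_simps u_cancel u_inverse)
  qed
  have 2: "dual_conn A m e E (legendre_conn A m e u (shift_conn A m D Z)) W = K W"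
    if "Z \<in> V" "W \<in> V" for Z W
    unfolding dual_conn_def K_def Let_def
  proof (intro restrict_ext)
    fix X Y assume "X \<in> V" "Y \<in> V"
    let ?D = "legendre_conn A m e u (shift_conn A m D Z)"
    show "E \<star> ?D X (inverse_field A m e E \<star> Y) - ?D (inverse_field A m e E \<star> Y) E \<star> X
        + W \<odot>\<^bsub>m'\<^esub> X \<odot>\<^bsub>m'\<^esub> Y =
      E \<star> (u' \<star> D X (E' \<star> (Y \<star> u))) - u' \<star> D (E' \<star> Y) (E \<star> u) \<star> X
        + W \<odot>\<^bsub>m'\<^esub> X \<odot>\<^bsub>m'\<^esub> Y"
      using that \<open>X \<in> V\<close> \<open>Y \<in> V\<close>
      by (simp add: legendre_conn_def inverse_u shift_conn_def dual_vmult ring_simps u_cancel u_inverse)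
  qed
  have "legendre_family A m' E (E \<star> u) {shift_conn A m' D' W |W. W \<in> V} = (\<lambda>W. K (W + r)) ` V"
    by (simp add: legendre_family_def Setcompr_eq_image image_image 1)
  \<comment> \<open>Translation by \<open>r\<close> permutes the vector fields, so the two
    parametrizations have the same image.\<close>
  also have "\<dots> = K ` V"
  proof -
    have "W \<in> (\<lambda>W. W + r) ` V" if "W \<in> V" for W
      using that by (intro image_eqI[of _ _ "W - r"]) simp_all
    then have "(\<lambda>W. W + r) ` V = V" by auto
    then show ?thesis by (metis image_image)
  qed
  also have "\<dots> = dual_family A m e E (legendre_family A m e u {shift_conn A m D Z |Z. Z \<in> V})"
  proof -
    have "V \<noteq> {}" using zero_closed by blast
    with 2 show ?thesis
      by (intro dual_family_eq_image[symmetric]) (auto simp: legendre_family_def)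
  qed
  finally show ?thesis by (simp add: dual_family_shift)
qed

end

end

theorem theorem35:
  fixes A :: "('a::{t2_space,second_countable_topology}, 'e::real_normed_vector) atlas"
    and m :: "'a tmult" and e \<E> u :: "'a vfield" and S :: "'a conn set"
  assumes "F_manifold A m e"
    and "special_family A m e S"
    and "legendre_field A m e S u"
    and "eventual_identity A m e \<E>"
  shows "legendre_field A (dual_mult A m e \<E>) \<E> (dual_family A m e \<E> S) (\<E> \<odot>\<^bsub>m\<^esub> u) \<and>
         legendre_family A (dual_mult A m e \<E>) \<E> (\<E> \<odot>\<^bsub>m\<^esub> u) (dual_family A m e \<E> S) =
           dual_family A m e \<E> (legendre_family A m e u S)"
proof -
  obtain D where D: "connection A D" "torsion_free A D" "compatible_conn A m D"
    and S: "S = {shift_conn A m D Z |Z. Z \<in> vfields A}"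
    using assms(2) unfolding special_family_def by blast
  interpret eventual_duality A m e \<E> "inverse_field A m e \<E>" D
    using D assms(4) by (intro eventual_duality.intro refl)
  obtain u' where u: "u \<in> vfields A" "u' \<in> vfields A" "u \<odot>\<^bsub>m\<^esub> u' = e"
    using assms(3) by (auto simp: legendre_field_def invertible_field_def)
  obtain Z where Z: "Z \<in> vfields A"
    and "\<And>X Y. X \<in> vfields A \<Longrightarrow> Y \<in> vfields A \<Longrightarrow>
      shift_conn A m D Z X u \<odot>\<^bsub>m\<^esub> Y = shift_conn A m D Z Y u \<odot>\<^bsub>m\<^esub> X"
    using assms(3) unfolding legendre_field_def S by blast
  \<comment> \<open>The shift by \<open>Z\<close> adds a product of \<open>Z\<close>,
    \<open>X\<close>, \<open>u\<close> and \<open>Y\<close>, symmetric in \<open>X\<close> and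
    \<open>Y\<close>, so the Legendre condition passes to the base connection.\<close>
  then have "D X u \<odot>\<^bsub>m\<^esub> Y = D Y u \<odot>\<^bsub>m\<^esub> X" if "X \<in> vfields A" "Y \<in> vfields A" for X Y
    using that u by (fastforce simp: shift_conn_def ring_simps)
  then show ?thesis
    using legendre_field_dual[OF u] legendre_family_dual[OF u] by (simp add: S)
qed

end
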